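(* Let $\varphi=\forall p_1,\dots,p_m.\,\psi$ be a parameterized pastLTL formula obtained by approximating a parameterized pastTSL formula, and let $\mathcal{W}$ be a finite-state machine over $2^{AP}$ (every transition label containing exactly one method-call proposition) such that every trace of $\mathcal{W}$ satisfies $\psi$ (with parameters treated as part of the proposition names). If $\mathcal{W}$ satisfies the Local Updates requirement and the Independence of Irrelevant Predicates requirement, and the split machines $\mathcal{W}_1,\dots,\mathcal{W}_n$ pass the independence check, then the constructed infinite-state machine $\mathcal{M}$ satisfies $\varphi$, i.e., for every instance $\mu:P\to\mathbb{P}$ and every $t_\mu\in\mathit{traces}_\mu(\mathcal{M})$, $t_\mu\models\psi[\mu]$.
   Context: PastLTL and approximation. A pastLTL formula is built from atomic propositions with $\neg,\wedge$, Yesterday $\mathbf{Y}$ and Since $\mathbf{S}$ (standard past-time semantics); a finite or infinite trace satisfies a pastLTL formula iff the formula holds at every position of the trace. A parameterized pastLTL formula is a closed formula $\forall p_1,\dots,p_m.\,\psi$ with $\psi$ a pastLTL formula over parameterized propositions; $\psi[\mu]$ replaces every parameter according to $\mu$. Approximating a parameterized pastTSL formula means replacing each predicate term by a fresh input proposition and each update term $[\![c\leftarrow\tau]\!]$ by a fresh output proposition (keeping the parameters occurring in the term as parameters of the proposition), and conjoining constraints that each cell is updated by exactly one term per step; method calls become method-call input propositions and self-updates $[\![c\leftarrow c]\!]$ become self-update output propositions. State machines. A state machine over $\Sigma$ is $(S,s_0,\delta)$ with $\delta\subseteq S\times\Sigma\times S$; $\mathit{traces}$/$\mathit{finTraces}$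 are the infinite/nonempty finite label sequences of runs from $s_0$. Propositions and instances. $P$ is a finite set of parameters, $P_1,\dots,P_n$ ($n=2^{|P|}$) all subsets of $P$. $AP=I\cup O$ (disjoint) is a finite set of propositions $a(Q)$, $Q$ a sequence of distinct parameters (identified with its set), each name with a single sequence. $I_{\mathit{call}}\subseteq I$ are method-call propositions, $O_{\mathit{self}}\subseteq O$ self-update propositions. $\mathbb{P}$ is a parameter domain; an instance is $\mu:P\to\mathbb{P}$; $a[\mu]$, $A[\mu]$, $Q[\mu]$ denote instantiation; $AP_\mathbb{P}=\{a[\mu]\}$. Requirements on $\mathcal{W}=(S_\mathcal{W},s^0_\mathcal{W},\delta_\mathcal{W})$. Local Updates: for every $(s,A,s')\in\delta_\mathcal{W}$, if $o(Q)\in A\cap O$ and $o(Q)\notin O_{\mathit{self}}$, then $A$ contains a method-call proposition with parameter sequence $Q$. Independence of Irrelevant Predicates: for every $(s,A,s')\in\delta_\mathcal{W}$ with a method-call proposition $f(Q)\in A$ and every $a(R)\in I\setminus I_{\mathit{call}}$ with $R\not\subseteq Q$, there is $(s,A',s')\in\delta_\mathcal{W}$ with ($a(R)\in A$ iff $a(R)\notin A'$) and $A\cap O=A'\cap O$. Splitting. Fresh guards $\mathit{in}_s$, $s\in S_\mathcal{W}$. $\mathcal{N}_i$: states $S_\mathcal{W}$, initial $s^0_\mathcal{W}$, and for each $(s,A,s')\in\delta_\mathcal{W}$ a transition $(s,A\cup\{\mathit{in}_s\},s')$ if $A$ contains a method-call proposition with parameter set exactly $P_i$, else an $\varepsilon$-transition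 $s\to s'$. $\mathcal{W}_i=(S_i,s^0_i,\delta_i)$ is the subset construction with $\varepsilon$-closures (initial: closure of $\{s^0_\mathcal{W}\}$; from $X$ on $L$ to the closure of $\{s'\mid\exists s\in X,(s,L,s')\in\mathcal{N}_i\}$ when nonempty); $K_i(X)\subseteq S_\mathcal{W}$ is the set represented by $X$. $G_{(s_i,A,s_i')}=\{s\mid(s_i,A\cup\{\mathit{in}_s\},s_i')\in\delta_i\}$ for $A\subseteq AP$. Independence check. For $P_{j_1},\dots,P_{j_l}$ all subsets of $P_i$, a transition $(s_i,A,s_i')$ of $\mathcal{W}_i$ is independent if for all $s_{j_k}\in S_{j_k}$ the set $X=K_i(s_i)\cap\bigcap_kK_{j_k}(s_{j_k})$ satisfies $X\subseteq G_{(s_i,A,s_i')}$ or $X\cap G_{(s_i,A,s_i')}=\emptyset$; the check succeeds if all transitions of all $\mathcal{W}_i$ are independent. $\mathcal{M}$ over $2^{AP_\mathbb{P}}$: states are tuples $(f_1,\dots,f_n)$, $f_i$ mapping instantiations of $P_i$ to $S_i$; initially every $f_i\equiv s^0_i$. For every state $(f_1,\dots,f_n)$, $i$, instance $\mu$, $s_i'\in S_i$, $A\subseteq AP$: with $s_i=f_i(P_i[\mu])$, if $K_i(s_i)\cap\bigcap_kK_{j_k}(f_{j_k}(P_{j_k}[\mu]))\subseteq G_{(s_i,A,s_i')}$ ($P_{j_k}$ ranging over subsets of $P_i$), add a transition labeled $A[\mu]\cup\{o[\mu']\mid o\in O_{\mathit{self}},o[\mu']\neq o[\mu]\}$ to $(f_1,\dots,f_i[P_i[\mu]\mapsto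 s_i'],\dots,f_n)$. Projection. For $B\subseteq AP_\mathbb{P}$, $B_\mu=\{\alpha\in B\mid\exists a\in AP,\alpha=a[\mu]\}$. For a trace $t$ of $\mathcal{M}$, $t_\mu$ is obtained from $(t[0])_\mu(t[1])_\mu\cdots$ by deleting each position whose output propositions are all instances of $O_{\mathit{self}}$ and which contains no $f[\mu]$ with $f\in I_{\mathit{call}}$ (so $t_\mu$ may be finite); $\mathit{traces}_\mu(\mathcal{M})=\{t_\mu\mid t\in\mathit{traces}(\mathcal{M})\}$.
   Formalization: Independence of Irrelevant Predicates additionally requires A and A' to agree on all inputs other than a(R) (the claim fails without this), and "every trace of W satisfies ψ" covers finite as well as infinite traces (needed when W has deadlocks). *)

theory Defs
  imports Main "HOL-Library.FuncSet" "HOL-Library.Infinite_Set"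
begin

section \<open>Past-time LTL over finite and infinite traces\<close>

datatype (atoms: 'a) pltl =
    Atom 'a
  | Neg "'a pltl"
  | And "'a pltl" "'a pltl"
  | Yesterday "'a pltl"
  | Since "'a pltl" "'a pltl"

abbreviation Or :: "'a pltl \<Rightarrow> 'a pltl \<Rightarrow> 'a pltl" where
  "Or \<phi> \<psi> \<equiv> Neg (And (Neg \<phi>) (Neg \<psi>))"

primrec holds :: "(nat \<Rightarrow> 'a set) \<Rightarrow> nat \<Rightarrow> 'a pltl \<Rightarrow> bool" where
  "holds t i (Atom a) \<longleftrightarrow> a \<in> t i"
| "holds t i (Neg \<phi>) \<longleftrightarrow> \<not> holds t i \<phi>"
| "holds t i (And \<phi> \<psi>) \<longleftrightarrow> holds t i \<phi> \<and> holds t i \<psi>"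
| "holds t i (Yesterday \<phi>) \<longleftrightarrow> 0 < i \<and> holds t (i - 1) \<phi>"
| "holds t i (Since \<phi> \<psi>) \<longleftrightarrow>
     (\<exists>j\<le>i. holds t j \<psi> \<and> (\<forall>k. j < k \<and> k \<le> i \<longrightarrow> holds t k \<phi>))"

datatype 'l trace = FinTrace "'l list" | InfTrace "nat \<Rightarrow> 'l"

text \<open>A formula is required to hold at every position. The truth value at position \<open>i\<close> depends
  only on positions up to \<open>i\<close>, so indexing a finite trace with \<open>nth\<close> is harmless.\<close>

fun satisfies :: "'a set trace \<Rightarrow> 'a pltl \<Rightarrow> bool" (infix "\<Turnstile>" 50) where
  "FinTrace w \<Turnstile> \<psi> \<longleftrightarrow> (\<forall>i<length w. holds (\<lambda>k. w ! k) i \<psi>)"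
| "InfTrace t \<Turnstile> \<psi> \<longleftrightarrow> (\<forall>i. holds t i \<psi>)"


section \<open>State machines\<close>

record ('s, 'l) machine =
  states :: "'s set"
  init :: 's
  transitions :: "('s \<times> 'l \<times> 's) set"

definition wf_machine :: "'l set \<Rightarrow> ('s, 'l) machine \<Rightarrow> bool" where
  "wf_machine \<Sigma> M \<longleftrightarrow> init M \<in> states M \<and> transitions M \<subseteq> states M \<times> \<Sigma> \<times> states M"

definition traces :: "('s, 'l) machine \<Rightarrow> (nat \<Rightarrow> 'l) set" where
  "traces M = {t. \<exists>r. r 0 = init M \<and> (\<forall>k. (r k, t k, r (Suc k)) \<in> transitions M)}"

definition fin_traces :: "('s, 'l) machine \<Rightarrow> 'l list set" where
  "fin_traces M = {w. w \<noteq> [] \<and>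
     (\<exists>r. r 0 = init M \<and> (\<forall>k<length w. (r k, w ! k, r (Suc k)) \<in> transitions M))}"


section \<open>Propositions and instances\<close>

type_synonym ('n, 'p) atomic_prop = "'n \<times> 'p list"

record ('n, 'p) vocabulary =
  parameters :: "'p set"
  inputs :: "('n, 'p) atomic_prop set"
  outputs :: "('n, 'p) atomic_prop set"
  calls :: "('n, 'p) atomic_prop set"
  selfs :: "('n, 'p) atomic_prop set"

definition AP :: "('n, 'p) vocabulary \<Rightarrow> ('n, 'p) atomic_prop set" where
  "AP V = inputs V \<union> outputs V"

definition wf_vocabulary :: "('n, 'p) vocabulary \<Rightarrow> bool" where
  "wf_vocabulary V \<longleftrightarrow>
     finite (parameters V) \<and> finite (AP V) \<and> inputs V \<inter> outputs V = {} \<and>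
     calls V \<subseteq> inputs V \<and> selfs V \<subseteq> outputs V \<and>
     (\<forall>(a, Q)\<in>AP V. distinct Q \<and> set Q \<subseteq> parameters V) \<and>
     (\<forall>a Q R. (a, Q) \<in> AP V \<longrightarrow> (a, R) \<in> AP V \<longrightarrow> Q = R)"

text \<open>The parameter domain is the type \<open>'d\<close>. An instance is a total function on \<open>'p\<close>, of which
  only the values on \<open>parameters V\<close> are ever used. The instantiation \<open>Q[\<mu>]\<close> of a set \<open>Q\<close> of parameters
  is \<open>restrict \<mu> Q\<close>.\<close>

definition inst :: "('p \<Rightarrow> 'd) \<Rightarrow> ('n, 'p) atomic_prop \<Rightarrow> ('n, 'd) atomic_prop" where
  "inst \<mu> a = (fst a, map \<mu> (snd a))"

definition AP_inst :: "('n, 'p) vocabulary \<Rightarrow> ('n, 'd) atomic_prop set" where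
  "AP_inst V = {inst \<mu> a | \<mu> a. a \<in> AP V}"


section \<open>Parameterized past-time TSL and its approximation\<close>

type_synonym ('y, 'p) cell = "'y \<times> 'p list"

datatype ('y, 'p) fterm =
    Cell "('y, 'p) cell"
  | Input 'y "'p list"
  | Param 'p
  | App 'y "('y, 'p) fterm list"

datatype ('y, 'p) tsl_atom =
    Pred 'y "('y, 'p) fterm list"
  | Call 'y "'p list"
  | Update "('y, 'p) cell" "('y, 'p) fterm"

type_synonym ('y, 'p) past_tsl = "('y, 'p) tsl_atom pltl"

primrec fterm_params :: "('y, 'p) fterm \<Rightarrow> 'p set" where
  "fterm_params (Cell c) = set (snd c)"
| "fterm_params (Input x Q) = set Q"
| "fterm_params (Param p) = {p}"
| "fterm_params (App f \<tau>s) = \<Union> (set (map fterm_params \<tau>s))"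

primrec tsl_atom_params :: "('y, 'p) tsl_atom \<Rightarrow> 'p set" where
  "tsl_atom_params (Pred r \<tau>s) = \<Union> (set (map fterm_params \<tau>s))"
| "tsl_atom_params (Call f Q) = set Q"
| "tsl_atom_params (Update c \<tau>) = set (snd c) \<union> fterm_params \<tau>"

primrec fterm_cells :: "('y, 'p) fterm \<Rightarrow> ('y, 'p) cell list" where
  "fterm_cells (Cell c) = [c]"
| "fterm_cells (Input x Q) = []"
| "fterm_cells (Param p) = []"
| "fterm_cells (App f \<tau>s) = concat (map fterm_cells \<tau>s)"

primrec tsl_atom_cells :: "('y, 'p) tsl_atom \<Rightarrow> ('y, 'p) cell list" where
  "tsl_atom_cells (Pred r \<tau>s) = concat (map fterm_cells \<tau>s)"
| "tsl_atom_cells (Call f Q) = []"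
| "tsl_atom_cells (Update c \<tau>) = c # fterm_cells \<tau>"

primrec atom_list :: "'a pltl \<Rightarrow> 'a list" where
  "atom_list (Atom a) = [a]"
| "atom_list (Neg \<phi>) = atom_list \<phi>"
| "atom_list (And \<phi> \<psi>) = atom_list \<phi> @ atom_list \<psi>"
| "atom_list (Yesterday \<phi>) = atom_list \<phi>"
| "atom_list (Since \<phi> \<psi>) = atom_list \<phi> @ atom_list \<psi>"

definition tsl_cells :: "('y, 'p) past_tsl \<Rightarrow> ('y, 'p) cell list" where
  "tsl_cells \<chi> = remdups (concat (map tsl_atom_cells (atom_list \<chi>)))"

definition self_update :: "('y, 'p) cell \<Rightarrow> ('y, 'p) tsl_atom" where
  "self_update c = Update c (Cell c)"

definition proper_updates :: "('y, 'p) past_tsl \<Rightarrow> ('y, 'p) cell \<Rightarrow> ('y, 'p) tsl_atom list" where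
  "proper_updates \<chi> c = filter (\<lambda>x. \<exists>\<tau>. x = Update c \<tau> \<and> \<tau> \<noteq> Cell c) (remdups (atom_list \<chi>))"

text \<open>As is usual for TSL, the self-update of a cell is always one of its available update terms,
  whether or not it occurs in the formula.\<close>

definition tsl_terms :: "('y, 'p) past_tsl \<Rightarrow> ('y, 'p) tsl_atom set" where
  "tsl_terms \<chi> = atoms \<chi> \<union> self_update ` set (tsl_cells \<chi>)"

definition only :: "'a list \<Rightarrow> 'a \<Rightarrow> 'a pltl" where
  "only xs x = foldr (\<lambda>y. And (Neg (Atom y))) (filter (\<lambda>y. y \<noteq> x) xs) (Atom x)"

definition exactly_one :: "'a \<Rightarrow> 'a list \<Rightarrow> 'a pltl" where
  "exactly_one x xs = foldr (\<lambda>y. Or (only (x # xs) y)) xs (only (x # xs) x)"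

definition cell_constraint :: "('y, 'p) past_tsl \<Rightarrow> ('y, 'p) cell \<Rightarrow> ('y, 'p) past_tsl" where
  "cell_constraint \<chi> c = exactly_one (self_update c) (proper_updates \<chi> c)"

text \<open>The function \<open>\<rho>\<close> chooses the fresh propositions. Their parameter sequences list the
  parameters that occur in the replaced terms, in any order.\<close>

definition naming ::
  "('n, 'p) vocabulary \<Rightarrow> ('y, 'p) past_tsl \<Rightarrow> (('y, 'p) tsl_atom \<Rightarrow> ('n, 'p) atomic_prop) \<Rightarrow> bool" where
  "naming V \<chi> \<rho> \<longleftrightarrow>
     inj_on \<rho> (tsl_terms \<chi>) \<and>
     (\<forall>x\<in>tsl_terms \<chi>.
        set (snd (\<rho> x)) = tsl_atom_params x \<and>
        (case x of
           Pred r \<tau>s \<Rightarrow> \<rho> x \<in> inputs V - calls V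
         | Call f Q \<Rightarrow> \<rho> x \<in> calls V
         | Update c \<tau> \<Rightarrow> if \<tau> = Cell c then \<rho> x \<in> selfs V else \<rho> x \<in> outputs V - selfs V))"

definition approx_formula ::
  "(('y, 'p) tsl_atom \<Rightarrow> ('n, 'p) atomic_prop) \<Rightarrow> ('y, 'p) past_tsl \<Rightarrow> ('n, 'p) atomic_prop pltl" where
  "approx_formula \<rho> \<chi> = map_pltl \<rho> (foldr (\<lambda>c. And (cell_constraint \<chi> c)) (tsl_cells \<chi>) \<chi>)"

text \<open>A parameterized formula \<open>\<forall>p\<^sub>1,\<dots>,p\<^sub>m. \<psi>\<close>.\<close>

datatype ('p, 'a) quantified = Forall "'p list" "'a pltl"

definition approximation ::
  "('n, 'p) vocabulary \<Rightarrow> ('p, ('y, 'p) tsl_atom) quantified \<Rightarrow> ('p, ('n, 'p) atomic_prop) quantified \<Rightarrow> bool"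
where
  "approximation V \<Phi> \<phi> \<longleftrightarrow>
     (\<exists>ps \<chi> \<rho>. \<Phi> = Forall ps \<chi> \<and> (\<forall>x\<in>atoms \<chi>. tsl_atom_params x \<subseteq> set ps) \<and>
        parameters V = set ps \<and> naming V \<chi> \<rho> \<and> \<phi> = Forall ps (approx_formula \<rho> \<chi>))"


section \<open>Requirements on the machine\<close>

text \<open>Parameter sequences are compared as sets.\<close>

definition local_updates ::
  "('n, 'p) vocabulary \<Rightarrow> ('q, ('n, 'p) atomic_prop set) machine \<Rightarrow> bool" where
  "local_updates V W \<longleftrightarrow>
     (\<forall>(s, A, s')\<in>transitions W. \<forall>out\<in>A \<inter> outputs V. out \<notin> selfs V \<longrightarrow>
        (\<exists>f\<in>A \<inter> calls V. set (snd f) = set (snd out)))"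

text \<open>The label \<open>A'\<close> differs from \<open>A\<close> in the proposition \<open>a\<close> only: the outputs and all other inputs
  are kept. If the other inputs were allowed to change along with \<open>a\<close>, a machine could still
  correlate several irrelevant predicates, such as \<open>a(p)\<close> and \<open>b(q)\<close> in the specification
  \<open>a(p) \<longleftrightarrow> b(q)\<close> with a parameterless method, and splitting would not be sound.\<close>

definition independent_of_irrelevant_predicates ::
  "('n, 'p) vocabulary \<Rightarrow> ('q, ('n, 'p) atomic_prop set) machine \<Rightarrow> bool" where
  "independent_of_irrelevant_predicates V W \<longleftrightarrow>
     (\<forall>(s, A, s')\<in>transitions W. \<forall>f\<in>A \<inter> calls V. \<forall>a\<in>inputs V - calls V.
        \<not> set (snd a) \<subseteq> set (snd f) \<longrightarrow>
        (\<exists>A'. (s, A', s') \<in> transitions W \<and> (a \<in> A \<longleftrightarrow> a \<notin> A') \<and>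
           A \<inter> outputs V = A' \<inter> outputs V \<and>
           A \<inter> (inputs V - {a}) = A' \<inter> (inputs V - {a})))"


section \<open>Splitting\<close>

datatype ('x, 'q) guarded = Prop 'x | Guard 'q

definition guard_label :: "'x set \<Rightarrow> 'q \<Rightarrow> ('x, 'q) guarded set" where
  "guard_label A s = Prop ` A \<union> {Guard s}"

text \<open>Labels of machines with \<open>\<epsilon>\<close>-transitions are options, with \<open>None\<close> for \<open>\<epsilon>\<close>. The machines
  \<open>\<N>\<^sub>i\<close> and \<open>\<W>\<^sub>i\<close> are indexed by the subset \<open>Q\<close> of parameters itself.\<close>

definition split_nfa ::
  "('n, 'p) vocabulary \<Rightarrow> ('q, ('n, 'p) atomic_prop set) machine \<Rightarrow> 'p set \<Rightarrow>
   ('q, (('n, 'p) atomic_prop, 'q) guarded set option) machine" where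
  "split_nfa V W Q =
     \<lparr>states = states W, init = init W,
      transitions = {(s, if \<exists>f\<in>A \<inter> calls V. set (snd f) = Q then Some (guard_label A s) else None, s') |
                 s A s'. (s, A, s') \<in> transitions W}\<rparr>"

definition eps_closure :: "('q, 'l option) machine \<Rightarrow> 'q set \<Rightarrow> 'q set" where
  "eps_closure N X = {(s, s'). (s, None, s') \<in> transitions N}\<^sup>* `` X"

definition det_step :: "('q, 'l option) machine \<Rightarrow> 'q set \<Rightarrow> 'l \<Rightarrow> 'q set" where
  "det_step N X l = eps_closure N {s'. \<exists>s\<in>X. (s, Some l, s') \<in> transitions N}"

inductive_set det_states :: "('q, 'l option) machine \<Rightarrow> 'q set set" for N where
  init: "eps_closure N {init N} \<in> det_states N"
| step: "X \<in> det_states N \<Longrightarrow> det_step N X l \<noteq> {} \<Longrightarrow> det_step N X l \<in> det_states N"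

text \<open>A state of the subset construction is the set that it represents, so the map \<open>K\<^sub>i\<close> is the
  identity.\<close>

definition determinize :: "('q, 'l option) machine \<Rightarrow> ('q set, 'l) machine" where
  "determinize N =
     \<lparr>states = det_states N, init = eps_closure N {init N},
      transitions = {(X, l, det_step N X l) | X l. X \<in> det_states N \<and> det_step N X l \<noteq> {}}\<rparr>"

definition split_machine ::
  "('n, 'p) vocabulary \<Rightarrow> ('q, ('n, 'p) atomic_prop set) machine \<Rightarrow> 'p set \<Rightarrow>
   ('q set, (('n, 'p) atomic_prop, 'q) guarded set) machine" where
  "split_machine V W Q = determinize (split_nfa V W Q)"

definition guards ::
  "('n, 'p) vocabulary \<Rightarrow> ('q, ('n, 'p) atomic_prop set) machine \<Rightarrow> 'p set \<Rightarrow>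
   'q set \<Rightarrow> ('n, 'p) atomic_prop set \<Rightarrow> 'q set \<Rightarrow> 'q set" where
  "guards V W Q X A X' = {s. (X, guard_label A s, X') \<in> transitions (split_machine V W Q)}"

definition independent_transition ::
  "('n, 'p) vocabulary \<Rightarrow> ('q, ('n, 'p) atomic_prop set) machine \<Rightarrow> 'p set \<Rightarrow>
   'q set \<Rightarrow> ('n, 'p) atomic_prop set \<Rightarrow> 'q set \<Rightarrow> bool" where
  "independent_transition V W Q X A X' \<longleftrightarrow>
     (\<forall>\<sigma>. (\<forall>R\<in>Pow Q. \<sigma> R \<in> states (split_machine V W R)) \<longrightarrow>
        X \<inter> (\<Inter>R\<in>Pow Q. \<sigma> R) \<subseteq> guards V W Q X A X' \<or>
        (X \<inter> (\<Inter>R\<in>Pow Q. \<sigma> R)) \<inter> guards V W Q X A X' = {})"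

definition independence_check ::
  "('n, 'p) vocabulary \<Rightarrow> ('q, ('n, 'p) atomic_prop set) machine \<Rightarrow> bool" where
  "independence_check V W \<longleftrightarrow>
     (\<forall>Q\<in>Pow (parameters V). \<forall>X A s X'. A \<subseteq> AP V \<longrightarrow>
        (X, guard_label A s, X') \<in> transitions (split_machine V W Q) \<longrightarrow> independent_transition V W Q X A X')"


section \<open>The infinite-state machine\<close>

text \<open>The tuple \<open>(f\<^sub>1, \<dots>, f\<^sub>n)\<close> is a function on the subsets of the parameters.\<close>

definition combined ::
  "('n, 'p) vocabulary \<Rightarrow> ('q, ('n, 'p) atomic_prop set) machine \<Rightarrow>
   ('p set \<Rightarrow> ('p \<Rightarrow> 'd) \<Rightarrow> 'q set, ('n, 'd) atomic_prop set) machine" where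
  "combined V W =
     (let St = (\<Pi>\<^sub>E Q\<in>Pow (parameters V). (Q \<rightarrow>\<^sub>E UNIV) \<rightarrow>\<^sub>E states (split_machine V W Q)) in
      \<lparr>states = St,
       init = (\<lambda>Q\<in>Pow (parameters V). \<lambda>\<nu>\<in>Q \<rightarrow>\<^sub>E UNIV. init (split_machine V W Q)),
       transitions = {(f,
                 inst \<mu> ` A \<union> {inst \<mu>' out | \<mu>' out. out \<in> selfs V \<and> inst \<mu>' out \<noteq> inst \<mu> out},
                 f(Q := (f Q)(restrict \<mu> Q := X'))) |
                f Q \<mu> X' A.
                f \<in> St \<and> Q \<in> Pow (parameters V) \<and> X' \<in> states (split_machine V W Q) \<and> A \<subseteq> AP V \<and>
                f Q (restrict \<mu> Q) \<inter> (\<Inter>R\<in>Pow Q. f R (restrict \<mu> R))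
                  \<subseteq> guards V W Q (f Q (restrict \<mu> Q)) A X'}\<rparr>)"

lemma wf_combined:
  fixes V :: "('n, 'p) vocabulary" and W :: "('q, ('n, 'p) atomic_prop set) machine"
  assumes "wf_vocabulary V"
  shows "wf_machine (Pow (AP_inst V)) (combined V W ::
           ('p set \<Rightarrow> ('p \<Rightarrow> 'd) \<Rightarrow> 'q set, ('n, 'd) atomic_prop set) machine)"
    (is "wf_machine _ ?M")
proof -
  define St :: "('p set \<Rightarrow> ('p \<Rightarrow> 'd) \<Rightarrow> 'q set) set"
    where "St = (\<Pi>\<^sub>E Q\<in>Pow (parameters V). (Q \<rightarrow>\<^sub>E UNIV) \<rightarrow>\<^sub>E states (split_machine V W Q))"
  have init: "init (split_machine V W Q) \<in> states (split_machine V W Q)" for Q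
    by (simp add: split_machine_def determinize_def det_states.init)
  have upd: "f(Q := (f Q)(restrict \<mu> Q := X')) \<in> St"
    if f: "f \<in> St" and Q: "Q \<in> Pow (parameters V)" and X': "X' \<in> states (split_machine V W Q)"
    for f Q \<mu> X'
  proof -
    note f = f[unfolded St_def]
    have "restrict \<mu> Q \<in> Q \<rightarrow>\<^sub>E UNIV"
      by simp
    with PiE_fun_upd[OF X' PiE_mem[OF f Q], of "restrict \<mu> Q"]
    have "(f Q)(restrict \<mu> Q := X') \<in> (Q \<rightarrow>\<^sub>E UNIV) \<rightarrow>\<^sub>E states (split_machine V W Q)"
      by (simp only: insert_absorb)
    from PiE_fun_upd[where T = "\<lambda>Q. (Q \<rightarrow>\<^sub>E UNIV) \<rightarrow>\<^sub>E states (split_machine V W Q)", OF this f]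
    show ?thesis
      unfolding St_def using Q by (simp only: insert_absorb)
  qed
  have label: "inst \<mu> ` A \<union> {inst \<mu>' out | \<mu>' out. out \<in> selfs V \<and> inst \<mu>' out \<noteq> inst \<mu> out}
      \<subseteq> AP_inst V" if "A \<subseteq> AP V" for \<mu> :: "'p \<Rightarrow> 'd" and A
  proof -
    have "selfs V \<subseteq> AP V"
      using assms by (auto simp: wf_vocabulary_def AP_def)
    with that show ?thesis
      unfolding AP_inst_def by blast
  qed
  have "init ?M \<in> St"
    unfolding combined_def Let_def St_def by (simp add: init)
  moreover have "transitions ?M \<subseteq> St \<times> Pow (AP_inst V) \<times> St"
  proof
    fix x assume "x \<in> transitions ?M"
    then obtain f Q \<mu> X' A
      where *: "f \<in> St" "Q \<in> Pow (parameters V)" "X' \<in> states (split_machine V W Q)" "A \<subseteq> AP V"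
        and x: "x = (f, inst \<mu> ` A \<union>
          {inst \<mu>' out | \<mu>' out. out \<in> selfs V \<and> inst \<mu>' out \<noteq> inst \<mu> out},
          f(Q := (f Q)(restrict \<mu> Q := X')))"
      unfolding combined_def Let_def St_def[symmetric] machine.simps mem_Collect_eq by blast
    show "x \<in> St \<times> Pow (AP_inst V) \<times> St"
      unfolding x using *(1) label[OF *(4)] upd[OF *(1-3)] by (simp del: fun_upd_apply)
  qed
  moreover have "states ?M = St"
    by (simp add: combined_def Let_def St_def)
  ultimately show ?thesis
    by (simp add: wf_machine_def)
qed


section \<open>Projection to an instance\<close>

definition proj :: "('n, 'p) vocabulary \<Rightarrow> ('p \<Rightarrow> 'd) \<Rightarrow> ('n, 'd) atomic_prop set \<Rightarrow> ('n, 'd) atomic_prop set" where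
  "proj V \<mu> B = {\<alpha>\<in>B. \<exists>a\<in>AP V. \<alpha> = inst \<mu> a}"

definition deleted :: "('n, 'p) vocabulary \<Rightarrow> ('p \<Rightarrow> 'd) \<Rightarrow> ('n, 'd) atomic_prop set \<Rightarrow> bool" where
  "deleted V \<mu> B \<longleftrightarrow>
     (\<forall>\<alpha>\<in>B. (\<exists>out\<in>outputs V. \<exists>\<mu>'. \<alpha> = inst \<mu>' out) \<longrightarrow> (\<exists>out\<in>selfs V. \<exists>\<mu>'. \<alpha> = inst \<mu>' out)) \<and>
     (\<forall>f\<in>calls V. inst \<mu> f \<notin> B)"

definition proj_trace ::
  "('n, 'p) vocabulary \<Rightarrow> ('p \<Rightarrow> 'd) \<Rightarrow> (nat \<Rightarrow> ('n, 'd) atomic_prop set) \<Rightarrow> ('n, 'd) atomic_prop set trace" where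
  "proj_trace V \<mu> t =
     (let kept = {k. \<not> deleted V \<mu> (proj V \<mu> (t k))} in
      if finite kept then FinTrace (map (\<lambda>k. proj V \<mu> (t k)) (sorted_list_of_set kept))
      else InfTrace (\<lambda>i. proj V \<mu> (t (enumerate kept i))))"

definition proj_traces ::
  "('n, 'p) vocabulary \<Rightarrow> ('p \<Rightarrow> 'd) \<Rightarrow> ('s, ('n, 'd) atomic_prop set) machine \<Rightarrow> ('n, 'd) atomic_prop set trace set"
where
  "proj_traces V \<mu> M = proj_trace V \<mu> ` traces M"

end

theory Submission
  imports Defs
begin

text \<open>Fix a run of the combined machine. By induction along it, for every instance \<open>\<mu>\<close> the sets
  \<open>f\<^sub>R(R[\<mu>])\<close>, for \<open>R\<close> a set of parameters, have a common element that \<open>\<W>\<close> reaches on a finite trace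
  agreeing with the projection to \<open>\<mu>\<close> so far on the atoms of \<open>\<psi>\<close>. A step at \<open>Q\<close> and \<open>\<mu>'\<close> is kept by the
  projection iff \<open>\<mu>\<close> and \<open>\<mu>'\<close> agree on \<open>Q\<close>. If so, the common element satisfies the guard and \<open>\<W>\<close> can
  follow; the other components do not move but are closed under the resulting \<open>\<epsilon>\<close>-transition. The
  label projected to \<open>\<mu>\<close> lacks the irrelevant predicates on which \<open>\<mu>\<close> and \<open>\<mu>'\<close> differ, and those can
  be removed from the label of \<open>\<W>\<close>. Since past formulas only look at finite prefixes, this suffices.
  Nonemptiness of the intersections matters: over an empty one, any step would be enabled.\<close>

section \<open>Past-time formulas\<close>

text \<open>All operators look backwards, so agreement up to \<open>i\<close> on the atoms of
  \<open>\<phi>\<close> is enough. With \<open>g\<close> equal to \<open>\<rho>\<close>,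
  \<open>inst \<mu>\<close> or \<open>id\<close>, this carries truth between vocabularies and
  between traces.\<close>

lemma holds_map_pltl:
  assumes "\<And>k a. k \<le> i \<Longrightarrow> a \<in> atoms \<phi> \<Longrightarrow> a \<in> t k \<longleftrightarrow> g a \<in> u k"
  shows "holds u i (map_pltl g \<phi>) \<longleftrightarrow> holds t i \<phi>"
  using assms
proof (induction \<phi> arbitrary: i)
  case (Since \<phi> \<psi>)
  have "holds u k (map_pltl g \<phi>) \<longleftrightarrow> holds t k \<phi>" "holds u k (map_pltl g \<psi>) \<longleftrightarrow> holds t k \<psi>"
    if "k \<le> i" for k
    using Since.prems that by (intro Since.IH; simp)+
  then show ?case
    by (simp cong: conj_cong imp_cong)
qed auto

section \<open>Atoms and cell constraints of the approximated formula\<close>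

lemma set_atom_list: "set (atom_list \<phi>) = atoms \<phi>"
  by (induction \<phi>) auto

lemma atoms_only: "atoms (only xs x) \<subseteq> insert x (set xs)"
proof -
  have "atoms (foldr (\<lambda>y. And (Neg (Atom y))) ys (Atom x)) = insert x (set ys)" for ys
    by (induction ys) auto
  then show ?thesis
    unfolding only_def by auto
qed

lemma atoms_exactly_one: "atoms (exactly_one x xs) \<subseteq> insert x (set xs)"
proof -
  have "atoms (foldr (\<lambda>y. Or (only (x # xs) y)) ys (only (x # xs) x)) \<subseteq> insert x (set xs)"
    if "set ys \<subseteq> set xs" for ys
    using that
  proof (induction ys)
    case Nil
    then show ?case using atoms_only[of "x # xs" x] by auto
  next
    case (Cons y ys)
    then show ?case using atoms_only[of "x # xs" y] by auto
  qed
  then show ?thesis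
    unfolding exactly_one_def by blast
qed

lemma holds_onlyD: "holds t i (only xs x) \<Longrightarrow> x \<in> t i"
proof -
  have "holds t i (foldr (\<lambda>y. And (Neg (Atom y))) ys (Atom x)) \<Longrightarrow> x \<in> t i" for ys
    by (induction ys) auto
  then show "holds t i (only xs x) \<Longrightarrow> x \<in> t i"
    unfolding only_def .
qed

lemma holds_exactly_oneD:
  assumes "holds t i (exactly_one x xs)"
  obtains y where "y \<in> insert x (set xs)" "y \<in> t i"
proof -
  \<comment> \<open>Only the list of disjuncts varies in the induction; the list
    \<open>x # xs\<close> inside \<open>only\<close> stays fixed.\<close>
  have "\<exists>y\<in>insert x (set ys). y \<in> t i"
    if "holds t i (foldr (\<lambda>y. Or (only (x # xs) y)) ys (only (x # xs) x))" for ys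
    using that by (induction ys) (auto dest: holds_onlyD)
  with assms that show thesis
    unfolding exactly_one_def by blast
qed

lemma atoms_foldr_And: "atoms (foldr (\<lambda>c. And (F c)) cs \<phi>) = \<Union> (atoms ` F ` set cs) \<union> atoms \<phi>"
  by (induction cs) auto

lemma holds_foldr_And:
  "holds t i (foldr (\<lambda>c. And (F c)) cs \<phi>) \<longleftrightarrow> (\<forall>c\<in>set cs. holds t i (F c)) \<and> holds t i \<phi>"
  by (induction cs) auto

lemma set_proper_updates: "set (proper_updates \<chi> c) \<subseteq> tsl_terms \<chi>"
  unfolding proper_updates_def tsl_terms_def by (auto simp: set_atom_list)

lemma atoms_approx_formula: "atoms (approx_formula \<rho> \<chi>) \<subseteq> \<rho> ` tsl_terms \<chi>"
proof -
  have "atoms (cell_constraint \<chi> c) \<subseteq> tsl_terms \<chi>" if "c \<in> set (tsl_cells \<chi>)" for c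
    using that atoms_exactly_one[of "self_update c" "proper_updates \<chi> c"] set_proper_updates[of \<chi> c]
    unfolding cell_constraint_def tsl_terms_def by blast
  then show ?thesis
    unfolding approx_formula_def pltl.set_map atoms_foldr_And
    by (intro image_mono) (auto simp: tsl_terms_def)
qed

lemma approx_formula_updates:
  assumes "holds t i (approx_formula \<rho> \<chi>)" and c: "c \<in> set (tsl_cells \<chi>)"
  obtains \<tau> where "Update c \<tau> \<in> tsl_terms \<chi>" "\<rho> (Update c \<tau>) \<in> t i"
proof -
  \<comment> \<open>The preimage under \<open>\<rho>\<close> reads each label as a set of TSL atoms,
    which undoes the renaming of the formula.\<close>
  have "holds (\<lambda>k. \<rho> -` t k) i (cell_constraint \<chi> c)"
    using assms holds_map_pltl[of i _ "\<lambda>k. \<rho> -` t k" \<rho> t]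
    unfolding approx_formula_def by (simp add: holds_foldr_And)
  then obtain y where y: "y \<in> insert (self_update c) (set (proper_updates \<chi> c))" "\<rho> y \<in> t i"
    unfolding cell_constraint_def by (auto elim: holds_exactly_oneD)
  moreover have "y \<in> tsl_terms \<chi>"
    using y(1) c set_proper_updates[of \<chi> c] by (auto simp: tsl_terms_def)
  moreover obtain \<tau> where "y = Update c \<tau>"
    using y(1) by (auto simp: self_update_def proper_updates_def)
  ultimately show thesis
    using that by simp
qed

lemma cell_in_tsl_cells:
  assumes "Update c \<tau> \<in> tsl_terms \<chi>"
  shows "c \<in> set (tsl_cells \<chi>)"
  using assms unfolding tsl_terms_def tsl_cells_def self_update_def
  by (force simp: set_atom_list)


section \<open>Instances and projected labels\<close>

lemma naming_params:
  assumes "naming V \<chi> \<rho>" "x \<in> tsl_terms \<chi>"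
  shows "set (snd (\<rho> x)) = tsl_atom_params x"
  using assms unfolding naming_def by blast

lemma naming_kind:
  assumes "naming V \<chi> \<rho>" "x \<in> tsl_terms \<chi>"
  shows "case x of Pred r \<tau>s \<Rightarrow> \<rho> x \<in> inputs V - calls V | Call f Q \<Rightarrow> \<rho> x \<in> calls V
      | Update c \<tau> \<Rightarrow> if \<tau> = Cell c then \<rho> x \<in> selfs V else \<rho> x \<in> outputs V - selfs V"
  using assms unfolding naming_def by blast

lemma naming_in_AP:
  assumes "wf_vocabulary V" "naming V \<chi> \<rho>" "x \<in> tsl_terms \<chi>"
  shows "\<rho> x \<in> AP V"
proof -
  have "calls V \<subseteq> inputs V" "selfs V \<subseteq> outputs V"
    using assms(1) by (simp_all add: wf_vocabulary_def)
  with naming_kind[OF assms(2,3)] show ?thesis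
    by (cases x) (auto simp: AP_def split: if_splits)
qed

text \<open>A name has one parameter sequence, so it determines the proposition even across two
  instances.\<close>

lemma inst_eqD:
  assumes "wf_vocabulary V" "a \<in> AP V" "b \<in> AP V" "inst \<mu> a = inst \<mu>' b"
  shows "a = b" "\<forall>p\<in>set (snd a). \<mu> p = \<mu>' p"
proof -
  show "a = b"
  proof (cases a, cases b)
    fix n Q m R assume ab: "a = (n, Q)" "b = (m, R)"
    have "\<forall>n Q R. (n, Q) \<in> AP V \<longrightarrow> (n, R) \<in> AP V \<longrightarrow> Q = R"
      using assms(1) by (simp add: wf_vocabulary_def)
    moreover have "n = m"
      using assms(4) ab by (simp add: inst_def)
    ultimately show ?thesis
      using assms(2,3) ab by blast
  qed
  then show "\<forall>p\<in>set (snd a). \<mu> p = \<mu>' p"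
    using assms(4) by (simp add: inst_def)
qed

section \<open>Labels of the combined machine and their projections\<close>

lemma inst_eq_iff: "inst \<mu> a = inst \<mu>' a \<longleftrightarrow> (\<forall>p\<in>set (snd a). \<mu> p = \<mu>' p)"
  by (simp add: inst_def)

lemma restrict_eq_iff: "restrict \<mu> Q = restrict \<mu>' Q \<longleftrightarrow> (\<forall>p\<in>Q. \<mu> p = \<mu>' p)"
  by (auto simp: restrict_def fun_eq_iff)

definition step_label ::
  "('n, 'p) vocabulary \<Rightarrow> ('p \<Rightarrow> 'd) \<Rightarrow> ('n, 'p) atomic_prop set \<Rightarrow> ('n, 'd) atomic_prop set" where
  "step_label V \<mu> A = inst \<mu> ` A \<union> {inst \<mu>' out | \<mu>' out. out \<in> selfs V \<and> inst \<mu>' out \<noteq> inst \<mu> out}"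

text \<open>If the instances agree on the parameters of \<open>a\<close>, the added self-updates
  exclude \<open>inst \<mu> a\<close>, so \<open>A\<close> decides. Otherwise \<open>A\<close>
  cannot contribute it, and it is added exactly when \<open>a\<close> is a self-update.\<close>

lemma inst_mem_step_label:
  assumes V: "wf_vocabulary V" and A: "A \<subseteq> AP V" and a: "a \<in> AP V"
  shows "inst \<mu> a \<in> step_label V \<mu>' A \<longleftrightarrow>
    (if \<forall>p\<in>set (snd a). \<mu> p = \<mu>' p then a \<in> A else a \<in> selfs V)"
proof -
  have selfs: "selfs V \<subseteq> AP V"
    using V by (auto simp: wf_vocabulary_def AP_def)
  have "inst \<mu> a \<in> inst \<mu>' ` A \<longleftrightarrow> a \<in> A \<and> inst \<mu> a = inst \<mu>' a"
    using inst_eqD(1)[OF V a] A by blast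
  moreover have "(\<exists>\<mu>'' out. inst \<mu> a = inst \<mu>'' out \<and> out \<in> selfs V \<and> inst \<mu>'' out \<noteq> inst \<mu>' out)
      \<longleftrightarrow> a \<in> selfs V \<and> inst \<mu> a \<noteq> inst \<mu>' a"
    (is "?L \<longleftrightarrow> ?R")
  proof
    assume ?L
    then obtain \<mu>'' out where out: "inst \<mu> a = inst \<mu>'' out" "out \<in> selfs V" "inst \<mu>'' out \<noteq> inst \<mu>' out"
      by blast
    moreover have "a = out"
      using inst_eqD(1)[OF V a _ out(1)] out(2) selfs by blast
    ultimately show ?R by simp
  qed blast
  ultimately show ?thesis
    unfolding step_label_def by (auto simp: inst_eq_iff)
qed

text \<open>The call and all proper updates have the parameters of \<open>f\<close>. Where the
  instances disagree on these, none of them shows up in the projection; where they agree, the call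
  does and keeps the position.\<close>

lemma deleted_step_label_iff:
  assumes V: "wf_vocabulary V" and A: "A \<subseteq> AP V"
    and f: "f \<in> A \<inter> calls V" "\<And>g. g \<in> A \<inter> calls V \<Longrightarrow> g = f"
    and upd: "\<And>out. out \<in> A \<inter> outputs V \<Longrightarrow> out \<notin> selfs V \<Longrightarrow> set (snd out) = set (snd f)"
  shows "deleted V \<mu> (proj V \<mu> (step_label V \<mu>' A)) \<longleftrightarrow> \<not> (\<forall>p\<in>set (snd f). \<mu> p = \<mu>' p)"
proof
  have disj: "inputs V \<inter> outputs V = {}" and calls: "calls V \<subseteq> inputs V" and selfs: "selfs V \<subseteq> outputs V"
    using V by (auto simp: wf_vocabulary_def)
  note mem = inst_mem_step_label[OF V A]
  {
    assume "deleted V \<mu> (proj V \<mu> (step_label V \<mu>' A))"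
    then have "inst \<mu> f \<notin> step_label V \<mu>' A"
      using f(1) A unfolding deleted_def proj_def by blast
    then show "\<not> (\<forall>p\<in>set (snd f). \<mu> p = \<mu>' p)"
      using f(1) A mem[of f \<mu> \<mu>'] by (auto split: if_splits)
  next
    assume neq: "\<not> (\<forall>p\<in>set (snd f). \<mu> p = \<mu>' p)"
    have "\<exists>out\<in>selfs V. \<exists>\<mu>''. \<alpha> = inst \<mu>'' out"
      if \<alpha>: "\<alpha> \<in> proj V \<mu> (step_label V \<mu>' A)" "out \<in> outputs V" "\<alpha> = inst \<mu>'' out" for \<alpha> out \<mu>''
    proof -
      from \<alpha> obtain a where a: "a \<in> AP V" "inst \<mu> a \<in> step_label V \<mu>' A" "\<alpha> = inst \<mu> a"
        and out: "out \<in> outputs V" "inst \<mu> a = inst \<mu>'' out"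
        by (auto simp: proj_def)
      have "a = out"
        using inst_eqD(1)[OF V a(1) _ out(2)] out(1) by (simp add: AP_def)
      with mem[OF a(1), of \<mu> \<mu>'] a(2) out(1) upd[of a] neq have "a \<in> selfs V"
        by (auto split: if_splits)
      then show ?thesis using a(3) by blast
    qed
    moreover have "inst \<mu> g \<notin> proj V \<mu> (step_label V \<mu>' A)" if g: "g \<in> calls V" for g
    proof
      assume "inst \<mu> g \<in> proj V \<mu> (step_label V \<mu>' A)"
      then have "inst \<mu> g \<in> step_label V \<mu>' A"
        by (simp add: proj_def)
      moreover have "g \<in> AP V" "g \<notin> selfs V"
        using g calls selfs disj by (auto simp: AP_def)
      ultimately have "g \<in> A" "\<forall>p\<in>set (snd g). \<mu> p = \<mu>' p"
        using mem[of g \<mu> \<mu>'] by (auto split: if_splits)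
      with f(2)[of g] g neq show False by auto
    qed
    ultimately show "deleted V \<mu> (proj V \<mu> (step_label V \<mu>' A))"
      unfolding deleted_def by blast
  }
qed

section \<open>Following a step of the combined machine in \<open>W\<close>\<close>

lemma remove_irrelevant:
  assumes W: "wf_machine (Pow (AP V)) W" and ind: "independent_of_irrelevant_predicates V W"
    and tr: "(s, A, s') \<in> transitions W" and f: "f \<in> A \<inter> calls V"
    and D: "finite D" "D \<subseteq> {a \<in> inputs V - calls V. \<not> set (snd a) \<subseteq> set (snd f)}"
  shows "(s, A - D, s') \<in> transitions W"
  using D
proof (induction D rule: finite_induct)
  case empty
  with tr show ?case by simp
next
  case (insert a D)
  then have tr': "(s, A - D, s') \<in> transitions W" and a: "a \<in> inputs V - calls V" "\<not> set (snd a) \<subseteq> set (snd f)"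
    by auto
  show ?case
  proof (cases "a \<in> A - D")
    case True
    have f': "f \<in> (A - D) \<inter> calls V"
      using f insert.prems by blast
    \<comment> \<open>The requirement flips one predicate and fixes all else, so predicates can be
      removed one at a time; since labels lie in \<open>AP V\<close>, \<open>A'\<close> is then
      determined.\<close>
    obtain A' where A': "(s, A', s') \<in> transitions W" "a \<in> A - D \<longleftrightarrow> a \<notin> A'"
        "(A - D) \<inter> outputs V = A' \<inter> outputs V" "(A - D) \<inter> (inputs V - {a}) = A' \<inter> (inputs V - {a})"
      using ind[unfolded independent_of_irrelevant_predicates_def, THEN bspec, OF tr', unfolded prod.case,
        THEN bspec, OF f', THEN bspec, OF a(1)] a(2) by blast
    have "A' \<subseteq> AP V" "A - D \<subseteq> AP V"
      using A'(1) tr' W by (auto simp: wf_machine_def)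
    with A'(2-4) True have "A' = A - insert a D"
      by (auto simp: AP_def)
    with A'(1) show ?thesis by simp
  next
    case False
    then have "A - insert a D = A - D" by auto
    with tr' show ?thesis by simp
  qed
qed

text \<open>Unlike \<open>fin_traces\<close>, this records the final state and admits the empty word
  with which the induction along a run starts.\<close>

definition reaches :: "('s, 'l) machine \<Rightarrow> 'l list \<Rightarrow> 's \<Rightarrow> bool" where
  "reaches M w s \<longleftrightarrow>
     (\<exists>r. r 0 = init M \<and> (\<forall>k<length w. (r k, w ! k, r (Suc k)) \<in> transitions M) \<and> r (length w) = s)"

lemma reaches_Nil: "reaches M [] (init M)"
  by (auto simp: reaches_def)

lemma reaches_snoc:
  assumes "reaches M w s" "(s, l, s') \<in> transitions M"
  shows "reaches M (w @ [l]) s'"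
proof -
  from assms(1) obtain r where r: "r 0 = init M" "r (length w) = s"
      "\<And>k. k < length w \<Longrightarrow> (r k, w ! k, r (Suc k)) \<in> transitions M"
    unfolding reaches_def by blast
  then show ?thesis
    unfolding reaches_def using assms(2)
    by (intro exI[of _ "r(Suc (length w) := s')"]) (auto simp: nth_append less_Suc_eq)
qed

lemma reaches_fin_traces: "reaches M w s \<Longrightarrow> w \<noteq> [] \<Longrightarrow> w \<in> fin_traces M"
  unfolding reaches_def fin_traces_def by blast

text \<open>A self-update missing from \<open>A\<close> has its cell updated by another term of \<open>A\<close>, whose parameters
  are those of the call and contain those of the cell. Hence the self-updates that the combined
  machine adds for \<open>\<mu>\<close> are already in \<open>A\<close>, at least those that the formula can see.\<close>

lemma step_label_transfer:
  assumes V: "wf_vocabulary V" and W: "wf_machine (Pow (AP V)) W"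
    and naming: "naming V \<chi> \<rho>"
    and sat: "\<And>w. w \<in> fin_traces W \<Longrightarrow> FinTrace w \<Turnstile> approx_formula \<rho> \<chi>"
    and ind: "independent_of_irrelevant_predicates V W"
    and w: "reaches W w s" and tr: "(s, A, s') \<in> transitions W"
    and f: "f \<in> A \<inter> calls V" "\<And>g. g \<in> A \<inter> calls V \<Longrightarrow> g = f"
    and upd: "\<And>out. out \<in> A \<inter> outputs V \<Longrightarrow> out \<notin> selfs V \<Longrightarrow> set (snd out) = set (snd f)"
    and eq: "\<forall>p\<in>set (snd f). \<mu> p = \<mu>' p"
  obtains A' where "(s, A', s') \<in> transitions W"
    "\<And>a. a \<in> atoms (approx_formula \<rho> \<chi>) \<Longrightarrow> a \<in> A' \<longleftrightarrow> inst \<mu> a \<in> proj V \<mu> (step_label V \<mu>' A)"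
proof -
  have A: "A \<subseteq> AP V"
    using tr W by (auto simp: wf_machine_def)
  have disj: "inputs V \<inter> outputs V = {}" and fin: "finite (AP V)"
    and selfs: "selfs V \<subseteq> outputs V" and calls: "calls V \<subseteq> inputs V"
    using V by (auto simp: wf_vocabulary_def)
  \<comment> \<open>These predicates may occur in \<open>A\<close> but never in the projection to
    \<open>\<mu>\<close>. As the instances agree on the parameters of \<open>f\<close>, each of them
    has a parameter outside those of \<open>f\<close>.\<close>
  define D where "D = {a \<in> inputs V - calls V. \<not> (\<forall>p\<in>set (snd a). \<mu> p = \<mu>' p)}"
  have "finite D"
    using fin by (rule rev_finite_subset) (auto simp: D_def AP_def)
  moreover have "D \<subseteq> {a \<in> inputs V - calls V. \<not> set (snd a) \<subseteq> set (snd f)}"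
    using eq unfolding D_def by blast
  ultimately have "(s, A - D, s') \<in> transitions W"
    by (rule remove_irrelevant[OF W ind tr f(1)])
  moreover have "a \<in> A - D \<longleftrightarrow> inst \<mu> a \<in> proj V \<mu> (step_label V \<mu>' A)"
    if a: "a \<in> atoms (approx_formula \<rho> \<chi>)" for a
  proof -
    from a atoms_approx_formula obtain x where x: "x \<in> tsl_terms \<chi>" "a = \<rho> x"
      by blast
    then have aAP: "a \<in> AP V"
      using naming_in_AP[OF V naming] by simp
    have *: "inst \<mu> a \<in> proj V \<mu> (step_label V \<mu>' A) \<longleftrightarrow>
        (if \<forall>p\<in>set (snd a). \<mu> p = \<mu>' p then a \<in> A else a \<in> selfs V)"
      unfolding inst_mem_step_label[OF V A aAP, symmetric] using aAP by (auto simp: proj_def)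
    show ?thesis
    proof (cases "\<forall>p\<in>set (snd a). \<mu> p = \<mu>' p")
      case True
      then show ?thesis using * by (auto simp: D_def)
    next
      case False
      have "a \<in> A - D \<longleftrightarrow> a \<in> selfs V"
      proof
        \<comment> \<open>Disagreement rules out the call and the proper updates, whose parameters
          are those of \<open>f\<close>; the predicates concerned lie in \<open>D\<close>.\<close>
        assume "a \<in> A - D"
        with False aAP f(2)[of a] upd[of a] eq show "a \<in> selfs V"
          unfolding D_def AP_def by auto
      next
        assume self: "a \<in> selfs V"
        then have "a \<notin> inputs V"
          using selfs disj by blast
        then obtain c where c: "x = Update c (Cell c)"
          using naming_kind[OF naming x(1)] x(2) self calls by (cases x) (auto split: if_splits)
        have c_params: "set (snd a) = set (snd c)"
          using naming_params[OF naming x(1)] x(2) c by simp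
        \<comment> \<open>The cell constraint is read at the last position, whose index is
          \<open>length w\<close> and whose label is \<open>A\<close>.\<close>
        have "w @ [A] \<in> fin_traces W"
          using reaches_snoc[OF w tr] by (rule reaches_fin_traces) simp
        from sat[OF this] have "holds (\<lambda>k. (w @ [A]) ! k) (length w) (approx_formula \<rho> \<chi>)"
          by simp
        then obtain \<tau> where \<tau>: "Update c \<tau> \<in> tsl_terms \<chi>" "\<rho> (Update c \<tau>) \<in> A"
          using approx_formula_updates cell_in_tsl_cells[OF x(1)[unfolded c]] by (metis nth_append_length)
        have "\<tau> = Cell c"
        proof (rule ccontr)
          assume "\<tau> \<noteq> Cell c"
          then have "\<rho> (Update c \<tau>) \<in> outputs V - selfs V"
            using naming_kind[OF naming \<tau>(1)] by simp
          moreover have "set (snd (\<rho> (Update c \<tau>))) = set (snd c) \<union> fterm_params \<tau>"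
            using naming_params[OF naming \<tau>(1)] by simp
          ultimately have "set (snd a) \<subseteq> set (snd f)"
            using upd[of "\<rho> (Update c \<tau>)"] \<tau>(2) c_params by auto
          with eq False show False by blast
        qed
        with \<tau>(2) x c \<open>a \<notin> inputs V\<close> show "a \<in> A - D"
          by (auto simp: D_def)
      qed
      with False * show ?thesis by (simp only: if_False)
    qed
  qed
  ultimately show thesis
    using that by blast
qed


section \<open>The split machines\<close>

lemma eps_closure_superset: "X \<subseteq> eps_closure N X"
  unfolding eps_closure_def by blast

text \<open>Both rules of \<open>det_states\<close> produce \<open>eps_closure N Y\<close> for some
  \<open>Y\<close>.\<close>

lemma det_states_eps_closed:
  assumes "X \<in> det_states N" "s \<in> X" "(s, None, s') \<in> transitions N"
  shows "s' \<in> X"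
proof -
  from assms(1) obtain Y where "X = eps_closure N Y"
    by cases (auto simp: det_step_def)
  with assms(2,3) show ?thesis
    unfolding eps_closure_def by (auto intro: rtrancl_into_rtrancl)
qed

lemma guard_label_inject: "guard_label A s = guard_label B s' \<longleftrightarrow> A = B \<and> s = s'"
  unfolding guard_label_def by (auto simp: set_eq_iff image_iff)

lemma states_split_machine: "states (split_machine V W Q) = det_states (split_nfa V W Q)"
  by (simp add: split_machine_def determinize_def)

lemma init_mem_init_split_machine: "init W \<in> init (split_machine V W Q)"
  using eps_closure_superset[of "{init W}"]
  by (auto simp: split_machine_def determinize_def split_nfa_def)

lemma split_nfa_SomeE:
  assumes "(s, Some l, s') \<in> transitions (split_nfa V W Q)"
  obtains A f where "(s, A, s') \<in> transitions W" "l = guard_label A s" "f \<in> A \<inter> calls V" "set (snd f) = Q"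
proof -
  from assms obtain A where A: "(s, A, s') \<in> transitions W"
      "Some l = (if \<exists>f\<in>A \<inter> calls V. set (snd f) = Q then Some (guard_label A s) else None)"
    unfolding split_nfa_def machine.simps mem_Collect_eq prod.inject by blast
  show thesis
  proof (cases "\<exists>f\<in>A \<inter> calls V. set (snd f) = Q")
    case True
    then show ?thesis using that A by (metis option.inject)
  next
    case False
    have "Some l = None"
      using A(2) by (simp only: if_not_P[OF False])
    then show ?thesis by simp
  qed
qed

text \<open>The closure of an empty set is empty, so the transition rests on a labelled step from
  some \<open>s\<^sub>1\<close> in \<open>X\<close>. The guard inside the label forces this source
  to be \<open>s\<close>, which turns the guard into a real step of \<open>W\<close> from
  \<open>s\<close>.\<close>

lemma mem_guardsE:
  assumes "s \<in> guards V W Q X A X'"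
  obtains s' f where "s' \<in> X'" "(s, A, s') \<in> transitions W" "f \<in> A \<inter> calls V" "set (snd f) = Q"
proof -
  let ?N = "split_nfa V W Q"
  let ?Y = "{s'. \<exists>s\<^sub>1\<in>X. (s\<^sub>1, Some (guard_label A s), s') \<in> transitions ?N}"
  from assms obtain l where "l = guard_label A s" "X' = det_step ?N X l" "det_step ?N X l \<noteq> {}"
    unfolding guards_def split_machine_def determinize_def machine.simps mem_Collect_eq prod.inject
    by blast
  then have X': "X' = eps_closure ?N ?Y" and "eps_closure ?N ?Y \<noteq> {}"
    unfolding det_step_def by simp_all
  then have "?Y \<noteq> {}"
    unfolding eps_closure_def by blast
  then obtain s\<^sub>1 s' where s': "(s\<^sub>1, Some (guard_label A s), s') \<in> transitions ?N" "s' \<in> ?Y"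
    by blast
  from s'(1) obtain B f where "(s\<^sub>1, B, s') \<in> transitions W" "guard_label A s = guard_label B s\<^sub>1"
      "f \<in> B \<inter> calls V" "set (snd f) = Q"
    by (rule split_nfa_SomeE)
  moreover have "s' \<in> X'"
    unfolding X' using s'(2) by (rule subsetD[OF eps_closure_superset])
  ultimately show thesis
    using that by (simp add: guard_label_inject)
qed

text \<open>In the machine for \<open>R\<close> such a step is silent, and its states are closed
  under silent steps. This keeps the components other than the updated one valid.\<close>

lemma split_states_stutter:
  assumes "X \<in> states (split_machine V W R)" "s \<in> X" "(s, A, s') \<in> transitions W"
    and "\<not> (\<exists>f\<in>A \<inter> calls V. set (snd f) = R)"
  shows "s' \<in> X"
proof -
  have "(s, None, s') \<in> transitions (split_nfa V W R)"
    unfolding split_nfa_def machine.simps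
    by (intro CollectI exI[of _ s] exI[of _ A] exI[of _ s'] conjI assms(3)) (simp only: if_not_P[OF assms(4)])
  with assms(1,2) show ?thesis
    unfolding states_split_machine by (rule det_states_eps_closed)
qed

text \<open>The inclusion in the guard set is made pointwise; the separate factor for
  \<open>Q\<close> is the case \<open>R = Q\<close>.\<close>

lemma combined_transitionE:
  fixes f f' :: "'p set \<Rightarrow> ('p \<Rightarrow> 'd) \<Rightarrow> 'q set"
  assumes "(f, l, f') \<in> transitions (combined V W)"
  obtains Q A \<mu> X' where
    "\<forall>R\<subseteq>parameters V. \<forall>\<nu>. f R (restrict \<nu> R) \<in> states (split_machine V W R)"
    "Q \<subseteq> parameters V" "A \<subseteq> AP V" "l = step_label V \<mu> A"
    "\<forall>s. (\<forall>R\<subseteq>Q. s \<in> f R (restrict \<mu> R)) \<longrightarrow> s \<in> guards V W Q (f Q (restrict \<mu> Q)) A X'"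
    "f' = f(Q := (f Q)(restrict \<mu> Q := X'))"
proof -
  define St :: "('p set \<Rightarrow> ('p \<Rightarrow> 'd) \<Rightarrow> 'q set) set"
    where "St = (\<Pi>\<^sub>E Q\<in>Pow (parameters V). (Q \<rightarrow>\<^sub>E UNIV) \<rightarrow>\<^sub>E states (split_machine V W Q))"
  from assms obtain Q \<mu> X' A where f: "f \<in> St" and Q: "Q \<in> Pow (parameters V)" and A: "A \<subseteq> AP V"
    and l: "l = step_label V \<mu> A"
    and gd: "f Q (restrict \<mu> Q) \<inter> (\<Inter>R\<in>Pow Q. f R (restrict \<mu> R)) \<subseteq> guards V W Q (f Q (restrict \<mu> Q)) A X'"
    and f': "f' = f(Q := (f Q)(restrict \<mu> Q := X'))"
    unfolding combined_def Let_def St_def[symmetric] machine.simps mem_Collect_eq prod.inject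
      step_label_def[symmetric]
    by blast
  show thesis
  proof (rule that[OF _ _ A l _ f']; (intro allI impI)?)
    fix R :: "'p set" and \<nu> :: "'p \<Rightarrow> 'd"
    assume "R \<subseteq> parameters V"
    then have "f R \<in> (R \<rightarrow>\<^sub>E UNIV) \<rightarrow>\<^sub>E states (split_machine V W R)"
      by (intro PiE_mem[OF f[unfolded St_def]]) simp
    moreover have "restrict \<nu> R \<in> R \<rightarrow>\<^sub>E UNIV"
      by simp
    ultimately show "f R (restrict \<nu> R) \<in> states (split_machine V W R)"
      by (rule PiE_mem)
  next
    show "Q \<subseteq> parameters V"
      using Q by simp
  next
    fix s assume "\<forall>R\<subseteq>Q. s \<in> f R (restrict \<mu> R)"
    then show "s \<in> guards V W Q (f Q (restrict \<mu> Q)) A X'"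
      by (intro subsetD[OF gd]) simp
  qed
qed


section \<open>Enumerating the kept positions\<close>

text \<open>Both lists are sorted and distinct, so comparing sets suffices. The \<open>Suc\<close>
  bounds include the position \<open>enumerate S i\<close> itself.\<close>

lemma filter_upt_enumerate:
  fixes S :: "nat set"
  assumes "infinite S"
  shows "filter (\<lambda>j. j \<in> S) [0..<Suc (enumerate S i)] = map (enumerate S) [0..<Suc i]"
proof (rule sorted_distinct_set_unique)
  show "sorted (map (enumerate S) [0..<Suc i])"
    by (simp only: sorted_map) (rule sorted_wrt_mono_rel[OF _ sorted_upt],
      simp only: enumerate_mono_le_iff[OF assms])
  show "distinct (map (enumerate S) [0..<Suc i])"
    using inj_enumerate[OF assms] by (simp only: distinct_map distinct_upt inj_on_subset[OF _ subset_UNIV])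
  have "{j \<in> S. j \<le> enumerate S i} = enumerate S ` {..i}"
  proof (intro equalityI subsetI)
    fix j assume j: "j \<in> {j \<in> S. j \<le> enumerate S i}"
    then obtain n where "enumerate S n = j"
      using enumerate_Ex assms by blast
    with j show "j \<in> enumerate S ` {..i}"
      using enumerate_mono_le_iff[OF assms] by auto
  qed (use enumerate_mono_le_iff[OF assms] enumerate_in_set[OF assms] in auto)
  then show "set (filter (\<lambda>j. j \<in> S) [0..<Suc (enumerate S i)]) = set (map (enumerate S) [0..<Suc i])"
    by (auto simp: less_Suc_eq_le atLeast0LessThan lessThan_Suc_atMost simp del: upt_Suc)
  show "sorted (filter (\<lambda>j. j \<in> S) [0..<Suc (enumerate S i)])"
    by (rule sorted_wrt_filter[OF sorted_upt])
  show "distinct (filter (\<lambda>j. j \<in> S) [0..<Suc (enumerate S i)])"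
    by (rule distinct_filter[OF distinct_upt])
qed

text \<open>Truth at a kept position depends only on the kept positions before and at it, so finite
  prefixes of \<open>t\<close> settle both the finite and the infinite projection.\<close>

lemma satisfies_proj_traceI:
  fixes t :: "nat \<Rightarrow> ('n, 'd) atomic_prop set" and V :: "('n, 'p) vocabulary" and \<mu> :: "'p \<Rightarrow> 'd"
  defines "js \<equiv> \<lambda>k. filter (\<lambda>j. \<not> deleted V \<mu> (proj V \<mu> (t j))) [0..<k]"
  assumes holds: "\<And>k i. i < length (js k) \<Longrightarrow> holds (\<lambda>m. map (\<lambda>j. proj V \<mu> (t j)) (js k) ! m) i \<phi>"
  shows "proj_trace V \<mu> t \<Turnstile> \<phi>"
proof -
  define S where "S = {j. \<not> deleted V \<mu> (proj V \<mu> (t j))}"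
  have js: "js k = filter (\<lambda>j. j \<in> S) [0..<k]" for k
    by (simp add: js_def S_def)
  show ?thesis
  proof (cases "finite S")
    case True
    then obtain k where "S \<subseteq> {..<k}"
      by (auto simp: finite_nat_iff_bounded)
    then have "set (js k) = S"
      by (auto simp: js)
    then have "sorted_list_of_set S = js k"
      by (metis js distinct_filter distinct_upt sorted_list_of_set.idem_if_sorted_distinct sorted_upt sorted_wrt_filter)
    with True holds show ?thesis
      by (simp add: proj_trace_def S_def[symmetric])
  next
    case False
    have "holds (\<lambda>m. proj V \<mu> (t (enumerate S m))) i \<phi>" for i
    proof -
      let ?k = "Suc (enumerate S i)"
      have eq: "js ?k = map (enumerate S) [0..<Suc i]"
        unfolding js by (rule filter_upt_enumerate[OF False])
      \<comment> \<open>Renaming by \<open>id\<close> lets \<open>holds_map_pltl\<close> compare two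
        traces that agree up to \<open>i\<close>.\<close>
      have "holds (\<lambda>m. map (\<lambda>j. proj V \<mu> (t j)) (js ?k) ! m) i (map_pltl id \<phi>) \<longleftrightarrow>
          holds (\<lambda>m. proj V \<mu> (t (enumerate S m))) i \<phi>"
        by (rule holds_map_pltl) (simp add: eq del: upt_Suc)
      with holds[of i ?k] eq show ?thesis
        by (simp add: pltl.map_id)
    qed
    with False show ?thesis
      by (simp add: proj_trace_def S_def[symmetric])
  qed
qed


section \<open>Soundness of the combined machine\<close>

text \<open>Matching is restricted to the atoms of the formula because \<open>combined\<close> may
  add self-updates of other cells that \<open>W\<close> does not perform. The induction is over all
  \<open>\<mu>\<close>, as a step at \<open>\<mu>'\<close> also needs the hypothesis at
  \<open>\<mu>'\<close>.\<close>

lemma combined_run_simulated: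
  fixes V :: "('n, 'p) vocabulary" and W :: "('q, ('n, 'p) atomic_prop set) machine" and \<mu> :: "'p \<Rightarrow> 'd"
    and r :: "nat \<Rightarrow> 'p set \<Rightarrow> ('p \<Rightarrow> 'd) \<Rightarrow> 'q set"
  assumes V: "wf_vocabulary V" and W: "wf_machine (Pow (AP V)) W"
    and naming: "naming V \<chi> \<rho>"
    and calls: "\<forall>(s, A, s')\<in>transitions W. \<exists>!f. f \<in> A \<inter> calls V"
    and sat: "\<And>w. w \<in> fin_traces W \<Longrightarrow> FinTrace w \<Turnstile> approx_formula \<rho> \<chi>"
    and loc: "local_updates V W" and ind: "independent_of_irrelevant_predicates V W"
    and r: "r 0 = init (combined V W)" "\<And>k. (r k, t k, r (Suc k)) \<in> transitions (combined V W)"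
  shows "\<exists>w s. reaches W w s \<and> (\<forall>R\<subseteq>parameters V. s \<in> r k R (restrict \<mu> R)) \<and>
    list_all2 (\<lambda>A j. \<forall>a\<in>atoms (approx_formula \<rho> \<chi>). a \<in> A \<longleftrightarrow> inst \<mu> a \<in> proj V \<mu> (t j))
      w (filter (\<lambda>j. \<not> deleted V \<mu> (proj V \<mu> (t j))) [0..<k])"
proof (induction k arbitrary: \<mu>)
  case 0
  have "r 0 R (restrict \<mu> R) = init (split_machine V W R)" if "R \<subseteq> parameters V" for R
    unfolding r(1) combined_def Let_def machine.simps using that by simp
  then have "\<forall>R\<subseteq>parameters V. init W \<in> r 0 R (restrict \<mu> R)"
    using init_mem_init_split_machine by metis
  moreover have "[0..<0] = []"
    by simp
  ultimately show ?case
    by (intro exI[of _ "[]"] exI[of _ "init W"] conjI reaches_Nil) (simp_all only: filter.simps list_all2_Nil)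
next
  case (Suc k)
  let ?match = "\<lambda>A j. \<forall>a\<in>atoms (approx_formula \<rho> \<chi>). a \<in> A \<longleftrightarrow> inst \<mu> a \<in> proj V \<mu> (t j)"
  let ?js = "\<lambda>k. filter (\<lambda>j. \<not> deleted V \<mu> (proj V \<mu> (t j))) [0..<k]"
  obtain Q A \<mu>' X' where
    st: "\<forall>R\<subseteq>parameters V. \<forall>\<nu>. r k R (restrict \<nu> R) \<in> states (split_machine V W R)" and
    Q: "Q \<subseteq> parameters V" and A: "A \<subseteq> AP V" and tk: "t k = step_label V \<mu>' A" and
    gd: "\<forall>s. (\<forall>R\<subseteq>Q. s \<in> r k R (restrict \<mu>' R)) \<longrightarrow> s \<in> guards V W Q (r k Q (restrict \<mu>' Q)) A X'" and
    rk: "r (Suc k) = (r k)(Q := (r k Q)(restrict \<mu>' Q := X'))"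
    by (rule combined_transitionE[OF r(2)[of k]])
  \<comment> \<open>The state \<open>s\<^sub>0\<close> shows that \<open>A\<close> labels a real
    transition of \<open>W\<close>, whether or not the step concerns \<open>\<mu>\<close>. Hence
    \<open>A\<close> has a unique call and satisfies Local Updates.\<close>
  from Suc.IH[of \<mu>'] obtain s\<^sub>0 where "\<forall>R\<subseteq>parameters V. s\<^sub>0 \<in> r k R (restrict \<mu>' R)"
    by blast
  then have "s\<^sub>0 \<in> guards V W Q (r k Q (restrict \<mu>' Q)) A X'"
    using Q by (intro gd[rule_format]) simp
  then obtain s\<^sub>0' f where "s\<^sub>0' \<in> X'" and s0: "(s\<^sub>0, A, s\<^sub>0') \<in> transitions W"
    and f: "f \<in> A \<inter> calls V" and fQ: "set (snd f) = Q"
    by (rule mem_guardsE)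
  have f_unique: "g = f" if "g \<in> A \<inter> calls V" for g
    using calls[THEN bspec, OF s0, unfolded prod.case] f that by blast
  have upd: "set (snd out) = set (snd f)" if out: "out \<in> A \<inter> outputs V" "out \<notin> selfs V" for out
  proof -
    obtain g where "g \<in> A \<inter> calls V" "set (snd g) = set (snd out)"
      using loc[unfolded local_updates_def, THEN bspec, OF s0, unfolded prod.case] out by blast
    with f_unique[of g] show ?thesis by simp
  qed
  have del: "deleted V \<mu> (proj V \<mu> (t k)) \<longleftrightarrow> restrict \<mu> Q \<noteq> restrict \<mu>' Q"
    using deleted_step_label_iff[OF V A f f_unique upd] by (simp add: tk fQ restrict_eq_iff)
  from Suc.IH[of \<mu>] obtain w s where w: "reaches W w s" and s: "\<forall>R\<subseteq>parameters V. s \<in> r k R (restrict \<mu> R)"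
    and match: "list_all2 ?match w (?js k)"
    by blast
  show ?case
  proof (cases "restrict \<mu> Q = restrict \<mu>' Q")
    case False
    then have "r (Suc k) R (restrict \<mu> R) = r k R (restrict \<mu> R)" for R
      unfolding rk by (cases "R = Q") simp_all
    then have "\<forall>R\<subseteq>parameters V. s \<in> r (Suc k) R (restrict \<mu> R)"
      using s by presburger
    moreover have "?js (Suc k) = ?js k"
      using False del by simp
    ultimately show ?thesis
      using w match by (intro exI[of _ w] exI[of _ s] conjI) (simp_all only:)
  next
    case True
    then have eq: "\<forall>p\<in>Q. \<mu> p = \<mu>' p"
      by (simp add: restrict_eq_iff)
    \<comment> \<open>Agreement on \<open>Q\<close> passes to its subsets, so the components read by
      the guard at \<open>\<mu>'\<close> are those containing \<open>s\<close>.\<close>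
    have "s \<in> r k R (restrict \<mu>' R)" if "R \<subseteq> Q" for R
    proof -
      have "restrict \<mu> R = restrict \<mu>' R"
        using eq that by (auto simp: restrict_eq_iff)
      then show ?thesis
        using s that Q by (metis subset_trans)
    qed
    from gd[rule_format, OF this] obtain s' f' where s': "s' \<in> X'" "(s, A, s') \<in> transitions W"
      and "f' \<in> A \<inter> calls V" "set (snd f') = Q"
      by (rule mem_guardsE)
    obtain A' where A': "(s, A', s') \<in> transitions W"
      "\<And>a. a \<in> atoms (approx_formula \<rho> \<chi>) \<Longrightarrow> a \<in> A' \<longleftrightarrow> inst \<mu> a \<in> proj V \<mu> (step_label V \<mu>' A)"
      using step_label_transfer[OF V W naming sat ind w s'(2) f f_unique upd eq[folded fQ]] by blast
    have "s' \<in> r (Suc k) R (restrict \<mu> R)" if R: "R \<subseteq> parameters V" for R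
    proof (cases "R = Q")
      case True
      with s'(1) \<open>restrict \<mu> Q = restrict \<mu>' Q\<close> show ?thesis
        unfolding rk by (simp only: fun_upd_same)
    next
      case False
      \<comment> \<open>The original label \<open>A\<close> shows that the step is silent for
        \<open>R\<close>, while \<open>A'\<close> extends the word; both lead from \<open>s\<close>
        to \<open>s'\<close>.\<close>
      then have "\<not> (\<exists>g\<in>A \<inter> calls V. set (snd g) = R)"
        using f_unique fQ by blast
      then have "s' \<in> r k R (restrict \<mu> R)"
        using split_states_stutter[OF st[rule_format, OF R] _ s'(2)] s R by blast
      with False show ?thesis
        unfolding rk by (simp only: fun_upd_other not_False_eq_True)
    qed
    moreover have "reaches W (w @ [A']) s'"
      by (rule reaches_snoc[OF w A'(1)])
    moreover have "list_all2 ?match (w @ [A']) (?js (Suc k))"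
      using match A'(2) True del by (simp add: list_all2_appendI tk)
    ultimately show ?thesis
      by blast
  qed
qed

theorem theorem2:
  fixes V :: "('n, 'p) vocabulary"
    and W :: "('q, ('n, 'p) atomic_prop set) machine"
    and \<Phi> :: "('p, ('y, 'p) tsl_atom) quantified"
    and ps :: "'p list"
    and \<psi> :: "('n, 'p) atomic_prop pltl"
  assumes "wf_vocabulary V"
    and "approximation V \<Phi> (Forall ps \<psi>)"
    and "wf_machine (Pow (AP V)) W" and "finite (states W)"
    and "\<forall>(s, A, s')\<in>transitions W. \<exists>!f. f \<in> A \<inter> calls V"
    and "\<forall>t\<in>InfTrace ` traces W \<union> FinTrace ` fin_traces W. t \<Turnstile> \<psi>"
    and "local_updates V W"
    and "independent_of_irrelevant_predicates V W"
    and "independence_check V W"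
  shows "\<forall>\<mu> :: 'p \<Rightarrow> 'd.
    \<forall>t\<in>proj_traces V \<mu> (combined V W :: ('p set \<Rightarrow> ('p \<Rightarrow> 'd) \<Rightarrow> 'q set, ('n, 'd) atomic_prop set) machine).
      t \<Turnstile> map_pltl (inst \<mu>) \<psi>"
proof (intro allI ballI)
  fix \<mu> :: "'p \<Rightarrow> 'd" and T
  assume "T \<in> proj_traces V \<mu> (combined V W :: ('p set \<Rightarrow> ('p \<Rightarrow> 'd) \<Rightarrow> 'q set, ('n, 'd) atomic_prop set) machine)"
  then obtain t and r :: "nat \<Rightarrow> 'p set \<Rightarrow> ('p \<Rightarrow> 'd) \<Rightarrow> 'q set" where T: "T = proj_trace V \<mu> t"
    and r: "r 0 = init (combined V W)" "\<And>k. (r k, t k, r (Suc k)) \<in> transitions (combined V W)"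
    by (auto simp: proj_traces_def traces_def)
  obtain \<chi> :: "('y, 'p) past_tsl" and \<rho> where naming: "naming V \<chi> \<rho>" and \<psi>: "\<psi> = approx_formula \<rho> \<chi>"
    using assms(2) unfolding approximation_def quantified.inject by blast
  have sat: "FinTrace w \<Turnstile> approx_formula \<rho> \<chi>" if "w \<in> fin_traces W" for w
    using assms(6) that \<psi> by blast
  show "T \<Turnstile> map_pltl (inst \<mu>) \<psi>"
    unfolding T
  proof (rule satisfies_proj_traceI)
    fix k i
    let ?js = "filter (\<lambda>j. \<not> deleted V \<mu> (proj V \<mu> (t j))) [0..<k]"
    assume i: "i < length ?js"
    obtain w s where w: "reaches W w s"
      and match: "list_all2 (\<lambda>A j. \<forall>a\<in>atoms \<psi>. a \<in> A \<longleftrightarrow> inst \<mu> a \<in> proj V \<mu> (t j)) w ?js"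
      using combined_run_simulated[OF assms(1,3) naming assms(5) sat assms(7,8) r] \<psi> by blast
    have len: "length w = length ?js"
      using match by (rule list_all2_lengthD)
    \<comment> \<open>\<open>fin_traces\<close> excludes the empty word; a position \<open>i\<close>
      to be checked rules it out.\<close>
    with i have "w \<noteq> []" by auto
    from sat[OF reaches_fin_traces[OF w this]] have "holds (\<lambda>m. w ! m) i \<psi>"
      using i len \<psi> by simp
    moreover have "holds (\<lambda>m. map (\<lambda>j. proj V \<mu> (t j)) ?js ! m) i (map_pltl (inst \<mu>) \<psi>) \<longleftrightarrow>
        holds (\<lambda>m. w ! m) i \<psi>"
      by (rule holds_map_pltl) (use match i in \<open>simp add: list_all2_conv_all_nth\<close>)
    ultimately show "holds (\<lambda>m. map (\<lambda>j. proj V \<mu> (t j)) ?js ! m) i (map_pltl (inst \<mu>) \<psi>)"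
      by simp
  qed
qed

end
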